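(* For all discounted sum games $\mathcal{G}$ (with any discount factor $0<\lambda<1$) and all strategies $\sigma_0\in\Sigma_0(\mathcal{G})$ of Player 0, $\mathsf{BR}_1(\sigma_0)\ne\varnothing$.
   Context: A (bi-weighted) arena $\mathcal{A}=(V,E,\langle V_0,V_1\rangle,w_0,w_1)$ consists of a finite set $V$ of vertices, a set $E\subseteq V\times V$ of edges such that every vertex has at least one outgoing edge, a partition $\langle V_0,V_1\rangle$ of $V$ ($V_i$ is owned by Player $i$), and two weight functions $w_0,w_1:E\to\mathbb{Z}$. A play is an infinite path $\pi=\pi_0\pi_1\dots$ of the arena; a history is a non-empty finite prefix of a play. Discounted sum game with discount factor $0<\lambda<1$: the payoff of Player $i\in\{0,1\}$ for a play $\pi$ is $\mathsf{DS}_i^\lambda(\pi)=\sum_{k=0}^\infty\lambda^k w_i(\pi_k,\pi_{k+1})$. A strategy of Player $i$ is a function mapping each history ending in a vertex $u\in V_i$ to a successor of $u$; $\Sigma_i(\mathcal{G})$ is the set of all strategies of Player $i$. For $v\in V$, $\mathsf{Out}_v(\sigma_0,\sigma_1)$ is the unique play starting in $v$ in which both players follow their strategies. Best-responses of Player 1 to $\sigma_0$: $\mathsf{BR}_1(\sigma_0)=\{\sigma_1\in\Sigma_1\mid \forall v\in V\ \forall\sigma_1'\in\Sigma_1:\ \mathsf{DS}_1^\lambda(\mathsf{Out}_v(\sigma_0,\sigma_1))\ge\mathsf{DS}_1^\lambda(\mathsf{Out}_v(\sigma_0,\sigma_1'))\}$. *)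

theory Defs
  imports Complex_Main "HOL-Library.FuncSet"
begin

datatype player = Player0 | Player1

record 'v arena =
  verts :: "'v set"
  edges :: "('v \<times> 'v) set"
  owned :: "player \<Rightarrow> 'v set"
  weight :: "player \<Rightarrow> 'v \<times> 'v \<Rightarrow> int"  \<comment> \<open>only the values on the edges matter\<close>

record 'v ds_game = "'v arena" +
  discount :: real

definition biweighted_arena :: "('v, 'b) arena_scheme \<Rightarrow> bool" where
  "biweighted_arena G \<longleftrightarrow>
     finite (verts G) \<and>
     edges G \<subseteq> verts G \<times> verts G \<and>
     (\<forall>u\<in>verts G. \<exists>v. (u, v) \<in> edges G) \<and>
     owned G Player0 \<union> owned G Player1 = verts G \<and>
     owned G Player0 \<inter> owned G Player1 = {}"

definition discounted_sum_game :: "'v ds_game \<Rightarrow> bool" where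
  "discounted_sum_game G \<longleftrightarrow> biweighted_arena G \<and> 0 < discount G \<and> discount G < 1"

definition plays :: "('v, 'b) arena_scheme \<Rightarrow> (nat \<Rightarrow> 'v) set" where
  "plays G = {\<pi>. \<forall>k. (\<pi> k, \<pi> (Suc k)) \<in> edges G}"

definition prefix_upto :: "(nat \<Rightarrow> 'v) \<Rightarrow> nat \<Rightarrow> 'v list" where
  "prefix_upto \<pi> n = map \<pi> [0..<Suc n]"

definition histories :: "('v, 'b) arena_scheme \<Rightarrow> 'v list set" where
  "histories G = {prefix_upto \<pi> n | \<pi> n. \<pi> \<in> plays G}"

text \<open>Strategies are functions on the histories ending in a vertex of the player, rendered
  as extensional functions (equal to \<^term>\<open>undefined\<close> on all other lists).\<close>

definition strategies :: "('v, 'b) arena_scheme \<Rightarrow> player \<Rightarrow> ('v list \<Rightarrow> 'v) set" where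
  "strategies G i =
     (\<Pi>\<^sub>E h\<in>{h \<in> histories G. last h \<in> owned G i}. {v. (last h, v) \<in> edges G})"

definition follows ::
    "('v, 'b) arena_scheme \<Rightarrow> player \<Rightarrow> ('v list \<Rightarrow> 'v) \<Rightarrow> (nat \<Rightarrow> 'v) \<Rightarrow> bool" where
  "follows G i \<sigma> \<pi> \<longleftrightarrow> (\<forall>k. \<pi> k \<in> owned G i \<longrightarrow> \<pi> (Suc k) = \<sigma> (prefix_upto \<pi> k))"

definition outcome ::
    "('v, 'b) arena_scheme \<Rightarrow> 'v \<Rightarrow> ('v list \<Rightarrow> 'v) \<Rightarrow> ('v list \<Rightarrow> 'v) \<Rightarrow> nat \<Rightarrow> 'v" where
  "outcome G v \<sigma>\<^sub>0 \<sigma>\<^sub>1 =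
     (THE \<pi>. \<pi> \<in> plays G \<and> \<pi> 0 = v \<and> follows G Player0 \<sigma>\<^sub>0 \<pi> \<and> follows G Player1 \<sigma>\<^sub>1 \<pi>)"

definition discounted_sum :: "'v ds_game \<Rightarrow> player \<Rightarrow> (nat \<Rightarrow> 'v) \<Rightarrow> real" where
  "discounted_sum G i \<pi> =
     (\<Sum>k. discount G ^ k * real_of_int (weight G i (\<pi> k, \<pi> (Suc k))))"

definition best_responses1 :: "'v ds_game \<Rightarrow> ('v list \<Rightarrow> 'v) \<Rightarrow> ('v list \<Rightarrow> 'v) set" where
  "best_responses1 G \<sigma>\<^sub>0 =
     {\<sigma>\<^sub>1 \<in> strategies G Player1.
        \<forall>v\<in>verts G. \<forall>\<sigma>\<^sub>1'\<in>strategies G Player1.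
          discounted_sum G Player1 (outcome G v \<sigma>\<^sub>0 \<sigma>\<^sub>1)
            \<ge> discounted_sum G Player1 (outcome G v \<sigma>\<^sub>0 \<sigma>\<^sub>1')}"

text \<open>The definite description in \<open>outcome\<close> and the series in \<open>discounted_sum\<close>
  are well-defined.\<close>

lemma prefix_upto_Suc: "prefix_upto \<pi> (Suc n) = prefix_upto \<pi> n @ [\<pi> (Suc n)]"
  by (simp add: prefix_upto_def)

lemma last_prefix_upto [simp]: "last (prefix_upto \<pi> n) = \<pi> n"
  by (simp add: prefix_upto_def)

lemma play_from:
  assumes "biweighted_arena G" "u \<in> verts G"
  obtains \<pi> where "\<pi> \<in> plays G" "\<pi> 0 = u"
proof -
  define s where "s x = (SOME y. (x, y) \<in> edges G)" for x
  have s: "(x, s x) \<in> edges G" if "x \<in> verts G" for x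
    using assms(1) that unfolding biweighted_arena_def s_def by (metis someI_ex)
  have "(s ^^ k) u \<in> verts G" for k
    by (induction k) (use assms s in \<open>auto simp: biweighted_arena_def\<close>)
  hence "(\<lambda>k. (s ^^ k) u) \<in> plays G" using s by (simp add: plays_def)
  thus thesis by (rule that) simp
qed

lemma history_singleton:
  assumes "biweighted_arena G" "u \<in> verts G"
  shows "[u] \<in> histories G"
proof -
  obtain \<pi> where "\<pi> \<in> plays G" "\<pi> 0 = u" using play_from[OF assms] .
  moreover have "prefix_upto \<pi> 0 = [\<pi> 0]" by (simp add: prefix_upto_def)
  ultimately show ?thesis unfolding histories_def by (metis (mono_tags, lifting) mem_Collect_eq)
qed

lemma history_append:
  assumes G: "biweighted_arena G" and h: "h \<in> histories G" and e: "(last h, u) \<in> edges G"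
  shows "h @ [u] \<in> histories G"
proof -
  obtain \<pi> n where \<pi>: "\<pi> \<in> plays G" "h = prefix_upto \<pi> n"
    using h by (auto simp: histories_def)
  have "u \<in> verts G" using G e by (auto simp: biweighted_arena_def)
  then obtain \<rho> where \<rho>: "\<rho> \<in> plays G" "\<rho> 0 = u" using play_from[OF G] by blast
  define \<tau> where "\<tau> k = (if k \<le> n then \<pi> k else \<rho> (k - Suc n))" for k
  have "(\<tau> k, \<tau> (Suc k)) \<in> edges G" for k
  proof (cases k n rule: linorder_cases)
    case less
    then show ?thesis using \<pi>(1) by (simp add: \<tau>_def plays_def)
  next
    case equal
    then show ?thesis using e \<pi>(2) \<rho>(2) by (simp add: \<tau>_def)
  next
    case greater
    then have "Suc k - Suc n = Suc (k - Suc n)" by simp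
    then show ?thesis using greater \<rho>(1) by (simp add: \<tau>_def plays_def)
  qed
  hence "\<tau> \<in> plays G" by (simp add: plays_def)
  moreover have "h @ [u] = prefix_upto \<tau> (Suc n)"
    using \<pi>(2) \<rho>(2) by (simp add: prefix_upto_def \<tau>_def)
  ultimately show ?thesis by (auto simp: histories_def)
qed

lemma strategy_edge:
  assumes "\<sigma> \<in> strategies G i" "h \<in> histories G" "last h \<in> owned G i"
  shows "(last h, \<sigma> h) \<in> edges G"
proof -
  have "h \<in> {h \<in> histories G. last h \<in> owned G i}" using assms by simp
  from PiE_mem[OF assms(1)[unfolded strategies_def] this] show ?thesis by simp
qed

theorem outcome_ex1:
  assumes G: "biweighted_arena G" and v: "v \<in> verts G"
    and \<sigma>0: "\<sigma>\<^sub>0 \<in> strategies G Player0" and \<sigma>1: "\<sigma>\<^sub>1 \<in> strategies G Player1"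
  shows "\<exists>!\<pi>. \<pi> \<in> plays G \<and> \<pi> 0 = v \<and> follows G Player0 \<sigma>\<^sub>0 \<pi> \<and> follows G Player1 \<sigma>\<^sub>1 \<pi>"
proof -
  define nxt where "nxt h = (if last h \<in> owned G Player0 then \<sigma>\<^sub>0 h else \<sigma>\<^sub>1 h)" for h
  define H where "H = rec_nat [v] (\<lambda>_ h. h @ [nxt h])"
  have H0: "H 0 = [v]" and HS: "H (Suc n) = H n @ [nxt (H n)]" for n
    by (simp_all add: H_def)
  define \<pi> where "\<pi> n = last (H n)" for n
  have pre: "prefix_upto \<pi> n = H n" for n
  proof (induction n)
    case 0
    then show ?case by (simp add: prefix_upto_def \<pi>_def H0)
  next
    case (Suc n)
    then show ?case by (simp add: prefix_upto_Suc HS) (simp add: \<pi>_def HS)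
  qed
  have step: "(last h, nxt h) \<in> edges G" if "h \<in> histories G" "last h \<in> verts G" for h
    using strategy_edge[OF \<sigma>0 that(1)] strategy_edge[OF \<sigma>1 that(1)] that(2) G
    by (auto simp: nxt_def biweighted_arena_def)
  have hist: "H n \<in> histories G \<and> last (H n) \<in> verts G" for n
  proof (induction n)
    case 0
    then show ?case using history_singleton[OF G v] v by (simp add: H0)
  next
    case (Suc n)
    then have "(last (H n), nxt (H n)) \<in> edges G" using step by blast
    then show ?case using history_append[OF G] Suc G
      by (auto simp: HS biweighted_arena_def)
  qed
  have \<pi>S: "\<pi> (Suc k) = nxt (prefix_upto \<pi> k)" for k
    by (simp add: pre) (simp add: \<pi>_def HS)
  have disj: "owned G Player0 \<inter> owned G Player1 = {}"
    using G by (simp add: biweighted_arena_def)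
  show ?thesis
  proof (rule ex1I[of _ \<pi>])
    have "(\<pi> k, \<pi> (Suc k)) \<in> edges G" for k
      using step[of "H k"] hist[of k] by (simp add: \<pi>_def HS)
    moreover have "\<pi> 0 = v" by (simp add: \<pi>_def H0)
    ultimately show "\<pi> \<in> plays G \<and> \<pi> 0 = v \<and> follows G Player0 \<sigma>\<^sub>0 \<pi> \<and> follows G Player1 \<sigma>\<^sub>1 \<pi>"
      using disj by (auto simp: plays_def follows_def \<pi>S nxt_def)
  next
    fix \<rho>
    assume \<rho>: "\<rho> \<in> plays G \<and> \<rho> 0 = v \<and> follows G Player0 \<sigma>\<^sub>0 \<rho> \<and> follows G Player1 \<sigma>\<^sub>1 \<rho>"
    have in_verts: "\<rho> k \<in> owned G Player0 \<union> owned G Player1" for k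
      using \<rho> G by (auto simp: plays_def biweighted_arena_def)
    have "prefix_upto \<rho> k = H k" for k
    proof (induction k)
      case 0
      then show ?case using \<rho> by (simp add: prefix_upto_def H0)
    next
      case (Suc k)
      have "\<rho> (Suc k) = nxt (prefix_upto \<rho> k)"
        using \<rho> in_verts[of k] by (auto simp: follows_def nxt_def)
      then show ?case using Suc by (simp add: prefix_upto_Suc HS)
    qed
    then show "\<rho> = \<pi>" by (metis ext last_prefix_upto \<pi>_def)
  qed
qed

lemma discounted_sum_summable:
  assumes "discounted_sum_game G" "\<pi> \<in> plays G"
  shows "summable (\<lambda>k. discount G ^ k * real_of_int (weight G i (\<pi> k, \<pi> (Suc k))))"
proof -
  have "finite (edges G)"
    using assms(1) finite_subset[of "edges G" "verts G \<times> verts G"]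
    by (auto simp: discounted_sum_game_def biweighted_arena_def)
  define W where "W = (\<Sum>e\<in>edges G. \<bar>real_of_int (weight G i e)\<bar>)"
  have W: "\<bar>real_of_int (weight G i e)\<bar> \<le> W" if "e \<in> edges G" for e
    unfolding W_def using \<open>finite (edges G)\<close> that by (intro member_le_sum) auto
  have d: "0 < discount G" "discount G < 1" using assms(1) by (auto simp: discounted_sum_game_def)
  show ?thesis
  proof (rule summable_comparison_test')
    show "summable (\<lambda>k. discount G ^ k * W)"
      using d by (intro summable_mult2 summable_geometric) auto
    show "norm (discount G ^ k * real_of_int (weight G i (\<pi> k, \<pi> (Suc k)))) \<le> discount G ^ k * W"
      if "k \<ge> 0" for k
      using W[of "(\<pi> k, \<pi> (Suc k))"] assms(2) d
      by (auto simp: abs_mult plays_def intro!: mult_left_mono)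
  qed
qed

end

theory Submission
  imports Defs
begin

text \<open>
  The plays from \<open>v\<close> consistent with \<open>\<sigma>\<^sub>0\<close> form a closed set of sequences over a finite
  alphabet, and the discounted sum is uniformly continuous with respect to agreement on
  prefixes; hence it is maximised by some play \<open>\<beta>\<^sub>v\<close>. The best response follows
  \<open>\<beta>\<^sub>v\<close>, where \<open>v\<close> is the first vertex of the history, and moves
  arbitrarily once the history has left \<open>\<beta>\<^sub>v\<close>.
\<close>

section \<open>Maxima on closed sets of sequences over a finite alphabet\<close>

text \<open>Compactness in the style of Koenig's lemma: a maximiser is built letter by letter,
  always keeping the supremum unchanged among the sequences that extend the current prefix. In
  \<open>cont\<close> one inequality suffices, since \<open>p\<close> and \<open>q\<close> may be
  exchanged.\<close>

lemma closed_sequence_set_attains_max: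
  fixes S :: "(nat \<Rightarrow> 'a) set" and f :: "(nat \<Rightarrow> 'a) \<Rightarrow> real"
  assumes "finite A" and range: "\<And>p k. p \<in> S \<Longrightarrow> p k \<in> A" and "S \<noteq> {}"
    and closed: "\<And>p. (\<And>n. \<exists>q\<in>S. \<forall>k<n. q k = p k) \<Longrightarrow> p \<in> S"
    and bdd: "bdd_above (f ` S)"
    and cont: "\<And>e. e > 0 \<Longrightarrow> \<exists>n. \<forall>p\<in>S. \<forall>q\<in>S. (\<forall>k<n. p k = q k) \<longrightarrow> f p \<le> f q + e"
  shows "\<exists>p\<in>S. \<forall>q\<in>S. f q \<le> f p"
proof -
  define M where "M = Sup (f ` S)"
  have le_M: "f q \<le> M" if "q \<in> S" for q
    unfolding M_def using that bdd by (intro cSup_upper) auto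
  \<comment> \<open>the supremum over the sequences that share the first \<open>n\<close> letters of \<open>p\<close> is still \<open>M\<close>\<close>
  define good where
    "good n p \<longleftrightarrow> (\<forall>e>0. \<exists>q\<in>S. (\<forall>k<n. q k = p k) \<and> f q > M - e)" for n and p :: "nat \<Rightarrow> 'a"
  have good_cong: "good n q" if "good n p" "\<And>k. k < n \<Longrightarrow> q k = p k" for n p q
    using that unfolding good_def by simp
  have good_0: "good 0 p" for p
  proof -
    have "\<exists>q\<in>S. f q > M - e" if "e > 0" for e
      using less_cSup_iff[of "f ` S" "M - e"] \<open>S \<noteq> {}\<close> bdd that by (auto simp: M_def)
    then show ?thesis by (auto simp: good_def)
  qed
  have good_Suc: "\<exists>x. good (Suc n) (p(n := x))" if "good n p" for n p
  proof (rule ccontr)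
    assume "\<not> ?thesis"
    then have "\<forall>x. \<exists>e>0. \<forall>q\<in>S. (\<forall>k<Suc n. q k = (p(n := x)) k) \<longrightarrow> f q \<le> M - e"
      unfolding good_def by (meson not_less)
    then obtain e where e: "e x > 0"
      and bad: "q \<in> S \<Longrightarrow> \<forall>k<Suc n. q k = (p(n := x)) k \<Longrightarrow> f q \<le> M - e x" for x q
      by metis
    have "A \<noteq> {}" using \<open>S \<noteq> {}\<close> range by auto
    \<comment> \<open>If every next letter \<open>x\<close> costs some \<open>e x > 0\<close>,
      finiteness of \<open>A\<close> yields a uniform cost \<open>d\<close>. A sequence of
      \<open>S\<close> extending the prefix with value above \<open>M - d\<close> then contradicts
      the cost of its own letter \<open>q n\<close>.\<close>
    define d where "d = Min (e ` A)"
    have "d > 0" and d_le: "x \<in> A \<Longrightarrow> d \<le> e x" for x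
      using \<open>finite A\<close> \<open>A \<noteq> {}\<close> e by (auto simp: d_def)
    obtain q where q: "q \<in> S" "\<forall>k<n. q k = p k" "f q > M - d"
      using \<open>good n p\<close> \<open>d > 0\<close> by (auto simp: good_def)
    have "f q \<le> M - e (q n)" using q by (intro bad) (auto simp: less_Suc_eq)
    with q(3) d_le[OF range[OF q(1)], of n] show False by simp
  qed
  have "\<exists>F. \<forall>n. good n (F n) \<and> (\<forall>k<n. F (Suc n) k = F n k)"
  proof (rule dependent_nat_choice)
    show "\<exists>p. good 0 p" using good_0 by blast
    show "\<exists>q. good (Suc n) q \<and> (\<forall>k<n. q k = p k)" if "good n p" for p n
      using good_Suc[OF that] by (metis fun_upd_apply less_irrefl)
  qed
  then obtain F where F: "\<And>n. good n (F n)" "\<And>n k. k < n \<Longrightarrow> F (Suc n) k = F n k"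
    by blast
  \<comment> \<open>Diagonal limit: stage \<open>n\<close> settles the letters below
    \<open>n\<close>, so letter \<open>k\<close> is final from stage \<open>Suc k\<close>
    on.\<close>
  define p where "p k = F (Suc k) k" for k
  have F_eq: "F n k = p k" if "Suc k \<le> n" for n k
    using that by (induction n rule: dec_induct) (auto simp: p_def F(2))
  have good_p: "good n p" for n
    using good_cong[OF F(1)] F_eq by auto
  have "p \<in> S"
  proof (rule closed)
    show "\<exists>q\<in>S. \<forall>k<n. q k = p k" for n
      \<comment> \<open>The tolerance 1 is arbitrary; only the agreement on the prefix is wanted
        here.\<close>
      using good_p[of n] zero_less_one unfolding good_def by blast
  qed
  moreover have "M \<le> f p"
  proof (rule field_le_epsilon)
    fix e :: real assume "e > 0"
    then obtain n where n: "\<forall>p\<in>S. \<forall>q\<in>S. (\<forall>k<n. p k = q k) \<longrightarrow> f p \<le> f q + e / 2"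
      using cont[of "e / 2"] by auto
    obtain q where "q \<in> S" "\<forall>k<n. q k = p k" "f q > M - e / 2"
      using good_p[of n] \<open>e > 0\<close> unfolding good_def by (meson half_gt_zero)
    with n \<open>p \<in> S\<close> have "f q \<le> f p + e / 2" by blast
    with \<open>f q > M - e / 2\<close> show "M \<le> f p + e" by simp
  qed
  ultimately show ?thesis using le_M by force
qed

section \<open>Boundedness and uniform continuity of the discounted sum\<close>

lemma discounted_sum_bounded:
  assumes G: "discounted_sum_game G"
  obtains C where "\<And>\<pi>. \<pi> \<in> plays G \<Longrightarrow> \<bar>discounted_sum G i \<pi>\<bar> \<le> C"
proof -
  have "finite (edges G)"
    using G finite_subset[of "edges G" "verts G \<times> verts G"]
    by (auto simp: discounted_sum_game_def biweighted_arena_def)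
  \<comment> \<open>The sum is a crude bound on each weight that, unlike a maximum, also makes sense
    without edges.\<close>
  define W where "W = (\<Sum>e\<in>edges G. \<bar>real_of_int (weight G i e)\<bar>)"
  have W: "\<bar>real_of_int (weight G i e)\<bar> \<le> W" if "e \<in> edges G" for e
    unfolding W_def using \<open>finite (edges G)\<close> that by (intro member_le_sum) auto
  have d: "0 < discount G" "discount G < 1" using G by (auto simp: discounted_sum_game_def)
  show ?thesis
  proof (rule that)
    fix \<pi> assume \<pi>: "\<pi> \<in> plays G"
    let ?t = "\<lambda>k. discount G ^ k * real_of_int (weight G i (\<pi> k, \<pi> (Suc k)))"
    have "norm (suminf ?t) \<le> (\<Sum>k. discount G ^ k * W)"
    proof (rule norm_suminf_le)
      show "norm (?t k) \<le> discount G ^ k * W" for k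
        using W[of "(\<pi> k, \<pi> (Suc k))"] \<pi> d
        by (auto simp: abs_mult plays_def intro!: mult_left_mono)
      show "summable (\<lambda>k. discount G ^ k * W)"
        using d by (intro summable_mult2 summable_geometric) auto
    qed
    then show "\<bar>discounted_sum G i \<pi>\<bar> \<le> (\<Sum>k. discount G ^ k * W)"
      by (simp add: discounted_sum_def)
  qed
qed

lemma play_suffix: "\<pi> \<in> plays G \<Longrightarrow> (\<lambda>k. \<pi> (k + n)) \<in> plays G"
  by (simp add: plays_def)

text \<open>A suffix of a play is a play, so the tail of the series is a scaled discounted sum, to
  which the uniform bound applies.\<close>

lemma discounted_sum_split:
  assumes G: "discounted_sum_game G" and \<pi>: "\<pi> \<in> plays G"
  shows "discounted_sum G i \<pi> =
    (\<Sum>k<n. discount G ^ k * real_of_int (weight G i (\<pi> k, \<pi> (Suc k))))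
      + discount G ^ n * discounted_sum G i (\<lambda>k. \<pi> (k + n))"
proof -
  have "discount G ^ n * discounted_sum G i (\<lambda>k. \<pi> (k + n)) =
      (\<Sum>k. discount G ^ n * (discount G ^ k * real_of_int (weight G i (\<pi> (k + n), \<pi> (Suc k + n)))))"
    unfolding discounted_sum_def
    using discounted_sum_summable[OF G play_suffix[OF \<pi>], of i n] by (rule suminf_mult[symmetric])
  also have "\<dots> = (\<Sum>k. discount G ^ (k + n) * real_of_int (weight G i (\<pi> (k + n), \<pi> (Suc (k + n)))))"
    by (simp add: power_add mult_ac)
  finally show ?thesis
    unfolding discounted_sum_def[of G i \<pi>]
    using suminf_split_initial_segment[OF discounted_sum_summable[OF G \<pi>, of i], of n] by simp
qed

lemma discounted_sum_uniformly_continuous: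
  assumes G: "discounted_sum_game G" and "e > 0"
  shows "\<exists>n. \<forall>\<pi>\<in>plays G. \<forall>\<rho>\<in>plays G. (\<forall>k<n. \<pi> k = \<rho> k) \<longrightarrow>
    discounted_sum G i \<pi> \<le> discounted_sum G i \<rho> + e"
proof -
  obtain C where C: "\<And>\<pi>. \<pi> \<in> plays G \<Longrightarrow> \<bar>discounted_sum G i \<pi>\<bar> \<le> C"
    using discounted_sum_bounded[OF G, of i] by blast
  let ?d = "discount G"
  have d: "0 < ?d" "?d < 1" using G by (auto simp: discounted_sum_game_def)
  have "(\<lambda>n. ?d ^ n * (2 * C)) \<longlonglongrightarrow> 0 * (2 * C)"
    using d by (intro tendsto_mult_right LIMSEQ_power_zero) auto
  then have "\<forall>\<^sub>F n in sequentially. ?d ^ n * (2 * C) < e"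
    using order_tendstoD(2) \<open>e > 0\<close> by fastforce
  then obtain n where n: "?d ^ n * (2 * C) < e"
    by (auto simp: eventually_sequentially)
  \<comment> \<open>The first \<open>n\<close> weights read \<open>n + 1\<close> vertices, hence
    agreement below \<open>Suc n\<close>. These weights cancel, and the two tails differ by at most
    \<open>?d ^ n * (2 * C)\<close>.\<close>
  have "discounted_sum G i \<pi> \<le> discounted_sum G i \<rho> + e"
    if \<pi>: "\<pi> \<in> plays G" and \<rho>: "\<rho> \<in> plays G" and eq: "\<forall>k<Suc n. \<pi> k = \<rho> k" for \<pi> \<rho>
  proof -
    let ?s = "\<lambda>\<pi>. discounted_sum G i (\<lambda>k. \<pi> (k + n))"
    have "discounted_sum G i \<pi> - discounted_sum G i \<rho> = ?d ^ n * (?s \<pi> - ?s \<rho>)"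
      using eq by (simp add: discounted_sum_split[OF G \<pi>, of i n]
          discounted_sum_split[OF G \<rho>, of i n] right_diff_distrib)
    also have "\<dots> \<le> ?d ^ n * (2 * C)"
      using C[OF play_suffix[OF \<pi>, of n]] C[OF play_suffix[OF \<rho>, of n]] d
      by (intro mult_left_mono) (auto simp: abs_le_iff)
    finally show ?thesis using n by simp
  qed
  then show ?thesis by blast
qed

section \<open>Plays consistent with a strategy, and the best among them\<close>

lemma prefix_upto_cong:
  assumes "\<And>k. k \<le> n \<Longrightarrow> \<pi> k = \<rho> k"
  shows "prefix_upto \<pi> n = prefix_upto \<rho> n"
  using assms by (simp add: prefix_upto_def)

lemma length_prefix_upto [simp]: "length (prefix_upto \<pi> n) = Suc n"
  by (simp add: prefix_upto_def)

lemma hd_prefix_upto [simp]: "hd (prefix_upto \<pi> n) = \<pi> 0"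
  by (simp add: prefix_upto_def hd_map del: upt_Suc)

text \<open>For \<open>Player0\<close> this set contains every outcome against a strategy of Player
  1, so the choice of a strategy can be replaced by the choice of a play.\<close>

definition consistent_plays ::
    "('v, 'b) arena_scheme \<Rightarrow> player \<Rightarrow> ('v list \<Rightarrow> 'v) \<Rightarrow> 'v \<Rightarrow> (nat \<Rightarrow> 'v) set" where
  "consistent_plays G i \<sigma> v = {\<pi> \<in> plays G. \<pi> 0 = v \<and> follows G i \<sigma> \<pi>}"

text \<open>Membership splits into conditions indexed by \<open>k\<close>, each reading only
  vertices up to index \<open>Suc k\<close>; an approximation that agrees on the first
  \<open>Suc (Suc k)\<close> vertices transfers it.\<close>

lemma consistent_plays_closed:
  assumes approx: "\<And>n. \<exists>\<rho>\<in>consistent_plays G i \<sigma> v. \<forall>k<n. \<rho> k = \<pi> k"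
  shows "\<pi> \<in> consistent_plays G i \<sigma> v"
proof -
  have "(\<pi> k, \<pi> (Suc k)) \<in> edges G \<and> \<pi> 0 = v \<and>
      (\<pi> k \<in> owned G i \<longrightarrow> \<pi> (Suc k) = \<sigma> (prefix_upto \<pi> k))" for k
  proof -
    obtain \<rho> where \<rho>: "\<rho> \<in> consistent_plays G i \<sigma> v" and eq: "\<forall>j<Suc (Suc k). \<rho> j = \<pi> j"
      using approx[of "Suc (Suc k)"] by blast
    have "prefix_upto \<rho> k = prefix_upto \<pi> k"
      by (rule prefix_upto_cong) (simp add: eq)
    moreover have "\<rho> 0 = \<pi> 0" "\<rho> k = \<pi> k" "\<rho> (Suc k) = \<pi> (Suc k)" by (simp_all add: eq)
    moreover have "(\<rho> k, \<rho> (Suc k)) \<in> edges G" "\<rho> 0 = v"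
      "\<rho> k \<in> owned G i \<longrightarrow> \<rho> (Suc k) = \<sigma> (prefix_upto \<rho> k)"
      using \<rho> by (simp_all add: consistent_plays_def plays_def follows_def)
    ultimately show ?thesis by simp
  qed
  then show ?thesis by (simp add: consistent_plays_def plays_def follows_def)
qed

lemma arena_successor:
  assumes "biweighted_arena G" "u \<in> owned G i"
  shows "\<exists>v. (u, v) \<in> edges G"
  using assms by (cases i) (auto simp: biweighted_arena_def)

lemma strategies_nonempty:
  assumes G: "biweighted_arena G"
  shows "strategies G i \<noteq> {}"
  using arena_successor[OF G] by (auto simp: strategies_def PiE_eq_empty_iff)

lemma outcome_properties:
  assumes "biweighted_arena G" "v \<in> verts G"
    and "\<sigma>\<^sub>0 \<in> strategies G Player0" "\<sigma>\<^sub>1 \<in> strategies G Player1"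
  shows "outcome G v \<sigma>\<^sub>0 \<sigma>\<^sub>1 \<in> consistent_plays G Player0 \<sigma>\<^sub>0 v"
    and "follows G Player1 \<sigma>\<^sub>1 (outcome G v \<sigma>\<^sub>0 \<sigma>\<^sub>1)"
  using theI'[OF outcome_ex1[OF assms]] unfolding outcome_def consistent_plays_def by auto

lemma outcome_eqI:
  assumes "biweighted_arena G" "v \<in> verts G"
    and "\<sigma>\<^sub>0 \<in> strategies G Player0" "\<sigma>\<^sub>1 \<in> strategies G Player1"
    and "\<pi> \<in> consistent_plays G Player0 \<sigma>\<^sub>0 v" "follows G Player1 \<sigma>\<^sub>1 \<pi>"
  shows "outcome G v \<sigma>\<^sub>0 \<sigma>\<^sub>1 = \<pi>"
  unfolding outcome_def
  using assms(5,6) by (intro the1_equality[OF outcome_ex1[OF assms(1-4)]])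
    (auto simp: consistent_plays_def)

lemma optimal_consistent_play:
  assumes G: "discounted_sum_game G" and \<sigma>0: "\<sigma>\<^sub>0 \<in> strategies G Player0" and v: "v \<in> verts G"
  shows "\<exists>\<pi>\<in>consistent_plays G Player0 \<sigma>\<^sub>0 v. \<forall>\<rho>\<in>consistent_plays G Player0 \<sigma>\<^sub>0 v.
    discounted_sum G i \<rho> \<le> discounted_sum G i \<pi>"
proof (rule closed_sequence_set_attains_max)
  let ?S = "consistent_plays G Player0 \<sigma>\<^sub>0 v"
  have A: "biweighted_arena G" using G by (simp add: discounted_sum_game_def)
  then show "finite (verts G)" by (simp add: biweighted_arena_def)
  show "\<pi> k \<in> verts G" if "\<pi> \<in> ?S" for \<pi> k
    using that A by (auto simp: consistent_plays_def plays_def biweighted_arena_def)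
  show "?S \<noteq> {}"
    using strategies_nonempty[OF A, of Player1] outcome_properties(1)[OF A v \<sigma>0] by blast
  show "\<pi> \<in> ?S" if "\<And>n. \<exists>\<rho>\<in>?S. \<forall>k<n. \<rho> k = \<pi> k" for \<pi>
    using that by (rule consistent_plays_closed)
  obtain C where C: "\<And>\<pi>. \<pi> \<in> plays G \<Longrightarrow> \<bar>discounted_sum G i \<pi>\<bar> \<le> C"
    using discounted_sum_bounded[OF G, of i] by blast
  show "bdd_above (discounted_sum G i ` ?S)"
    using C by (intro bdd_aboveI2[of _ _ C]) (auto simp: consistent_plays_def abs_le_iff)
  show "\<exists>n. \<forall>\<pi>\<in>?S. \<forall>\<rho>\<in>?S. (\<forall>k<n. \<pi> k = \<rho> k) \<longrightarrow>
      discounted_sum G i \<pi> \<le> discounted_sum G i \<rho> + e" if "e > 0" for e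
  proof -
    have "?S \<subseteq> plays G" by (auto simp: consistent_plays_def)
    then show ?thesis
      using discounted_sum_uniformly_continuous[OF G that, of i] by (meson subsetD)
  qed
qed

text \<open>One strategy serves all starting vertices at once: since \<open>b v\<close> starts in
  \<open>v\<close>, the head of a history tells which play to follow.\<close>

lemma strategy_following_plays:
  assumes G: "biweighted_arena G" and b: "\<And>v. v \<in> verts G \<Longrightarrow> b v \<in> plays G \<and> b v 0 = v"
  obtains \<sigma> where "\<sigma> \<in> strategies G i" "\<And>v. v \<in> verts G \<Longrightarrow> follows G i \<sigma> (b v)"
proof -
  \<comment> \<open>The last vertex of \<open>h\<close> has index \<open>length h - 1\<close>, so
    the move along the play is its entry at \<open>length h\<close>. Off the play any successor will
    do, and \<open>undefined\<close> elsewhere makes the function extensional.\<close>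
  define \<sigma> where "\<sigma> h =
    (if h \<in> histories G \<and> last h \<in> owned G i
     then if h = prefix_upto (b (hd h)) (length h - 1) then b (hd h) (length h)
          else SOME u. (last h, u) \<in> edges G
     else undefined)" for h
  have "(last h, \<sigma> h) \<in> edges G" if h: "h \<in> histories G" "last h \<in> owned G i" for h
  proof (cases "h = prefix_upto (b (hd h)) (length h - 1)")
    case True
    obtain \<pi> n where \<pi>: "\<pi> \<in> plays G" "h = prefix_upto \<pi> n" using h by (auto simp: histories_def)
    then have "hd h \<in> verts G" using G by (auto simp: plays_def biweighted_arena_def)
    then have "(b (hd h) n, b (hd h) (Suc n)) \<in> edges G" using b by (auto simp: plays_def)
    moreover have "last h = b (hd h) n"
      using arg_cong[OF True, of last] \<pi>(2) by simp
    moreover have "\<sigma> h = b (hd h) (length h)"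
      using True h by (metis \<sigma>_def)
    then have "\<sigma> h = b (hd h) (Suc n)" using \<pi>(2) by simp
    ultimately show ?thesis by simp
  next
    case False
    then show ?thesis
      using h someI_ex[OF arena_successor[OF G h(2)]] by (simp add: \<sigma>_def)
  qed
  then have "\<sigma> \<in> strategies G i"
    unfolding strategies_def by (intro PiE_I) (auto simp: \<sigma>_def)
  moreover have "follows G i \<sigma> (b v)" if "v \<in> verts G" for v
  proof -
    have "prefix_upto (b v) k \<in> histories G" for k
      using b[OF that] by (auto simp: histories_def)
    then show ?thesis using b[OF that] by (simp add: follows_def \<sigma>_def)
  qed
  ultimately show thesis by (rule that)
qed

theorem lemma13:
  fixes G :: "'v ds_game" and \<sigma>\<^sub>0 :: "'v list \<Rightarrow> 'v"
  assumes "discounted_sum_game G"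
    and "\<sigma>\<^sub>0 \<in> strategies G Player0"
  shows "best_responses1 G \<sigma>\<^sub>0 \<noteq> {}"
proof -
  have A: "biweighted_arena G" using assms(1) by (simp add: discounted_sum_game_def)
  let ?S = "consistent_plays G Player0 \<sigma>\<^sub>0"
  obtain b where b: "\<And>v. v \<in> verts G \<Longrightarrow> b v \<in> ?S v"
    and opt: "\<And>v \<rho>. v \<in> verts G \<Longrightarrow> \<rho> \<in> ?S v \<Longrightarrow>
      discounted_sum G Player1 \<rho> \<le> discounted_sum G Player1 (b v)"
    using optimal_consistent_play[OF assms, of _ Player1] by metis
  obtain \<sigma>\<^sub>1 where \<sigma>1: "\<sigma>\<^sub>1 \<in> strategies G Player1"
    and fol: "\<And>v. v \<in> verts G \<Longrightarrow> follows G Player1 \<sigma>\<^sub>1 (b v)"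
    using strategy_following_plays[OF A, of b Player1] b by (auto simp: consistent_plays_def)
  \<comment> \<open>The play \<open>b v\<close> is consistent with both strategies, so it is the
    outcome under \<open>\<sigma>\<^sub>1\<close>; any rival outcome is still consistent with
    \<open>\<sigma>\<^sub>0\<close> and cannot beat it.\<close>
  have "discounted_sum G Player1 (outcome G v \<sigma>\<^sub>0 \<sigma>\<^sub>1')
      \<le> discounted_sum G Player1 (outcome G v \<sigma>\<^sub>0 \<sigma>\<^sub>1)"
    if "v \<in> verts G" "\<sigma>\<^sub>1' \<in> strategies G Player1" for v \<sigma>\<^sub>1'
    using opt outcome_properties(1)[OF A that(1) assms(2) that(2)] that(1)
      outcome_eqI[OF A that(1) assms(2) \<sigma>1 b[OF that(1)] fol[OF that(1)]] by simp
  with \<sigma>1 have "\<sigma>\<^sub>1 \<in> best_responses1 G \<sigma>\<^sub>0" by (simp add: best_responses1_def)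
  then show ?thesis by blast
qed

end
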